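(* Let $G$ be a connected graph of order $n\geq 3$ with Randić index $R$, algebraic connectivity $a$, diameter $D$ and minimum degree $\delta$. If $D\leq \frac{2(n-3+2\sqrt{2})}{\pi^2}$ or $\delta\geq \frac{n}{2}$, then $$\frac{R}{a}\leq\left(\frac{n-3+2\sqrt{2}}{2}\right)\Big/\left(2\left(1-\cos\frac{\pi}{n}\right)\right).$$
   Context: For a graph $G=(V,E)$, the Randić index is $R(G)=\sum_{uv\in E(G)}\frac{1}{\sqrt{d(u)d(v)}}$, where $d(u)$ is the degree of $u$. The algebraic connectivity $a(G)$ is the second smallest eigenvalue of the Laplacian matrix $L(G)=D(G)-A(G)$ (diagonal degree matrix minus adjacency matrix). The diameter $D$ is the maximum distance between two vertices, and $\delta$ is the minimum vertex degree. *)

theory Defs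
  imports "HOL-Analysis.Analysis" "HOL-Computational_Algebra.Polynomial" "HOL-Library.Multiset"
begin

definition simple_graph :: "('n::finite \<Rightarrow> 'n \<Rightarrow> bool) \<Rightarrow> bool" where
  "simple_graph adj \<longleftrightarrow> (\<forall>u v. adj u v \<longleftrightarrow> adj v u) \<and> (\<forall>v. \<not> adj v v)"

definition degree :: "('n::finite \<Rightarrow> 'n \<Rightarrow> bool) \<Rightarrow> 'n \<Rightarrow> nat" where
  "degree adj v = card {u. adj v u}"

definition min_degree :: "('n::finite \<Rightarrow> 'n \<Rightarrow> bool) \<Rightarrow> nat" where
  "min_degree adj = Min (range (degree adj))"

fun walk :: "('n \<Rightarrow> 'n \<Rightarrow> bool) \<Rightarrow> nat \<Rightarrow> 'n \<Rightarrow> 'n \<Rightarrow> bool" where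
  "walk adj 0 u v \<longleftrightarrow> u = v"
| "walk adj (Suc k) u v \<longleftrightarrow> (\<exists>w. adj u w \<and> walk adj k w v)"

definition connected_graph :: "('n::finite \<Rightarrow> 'n \<Rightarrow> bool) \<Rightarrow> bool" where
  "connected_graph adj \<longleftrightarrow> (\<forall>u v. \<exists>k. walk adj k u v)"

definition graph_dist :: "('n::finite \<Rightarrow> 'n \<Rightarrow> bool) \<Rightarrow> 'n \<Rightarrow> 'n \<Rightarrow> nat" where
  "graph_dist adj u v = (LEAST k. walk adj k u v)"

definition diameter :: "('n::finite \<Rightarrow> 'n \<Rightarrow> bool) \<Rightarrow> nat" where
  "diameter adj = Max {graph_dist adj u v | u v. True}"

definition randic :: "('n::finite \<Rightarrow> 'n \<Rightarrow> bool) \<Rightarrow> real" where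
  "randic adj = (\<Sum>e\<in>{{u, v} | u v. adj u v}.
      (THE r. \<exists>u v. e = {u, v} \<and> adj u v \<and> r = 1 / sqrt (real (degree adj u) * real (degree adj v))))"

definition laplacian :: "('n::finite \<Rightarrow> 'n \<Rightarrow> bool) \<Rightarrow> real^'n^'n" where
  "laplacian adj = (\<chi> i j. (if i = j then real (degree adj i) else 0) - (if adj i j then 1 else 0))"

definition char_poly :: "real^'n^'n \<Rightarrow> real poly" where
  "char_poly M = det (\<chi> i j. (if i = j then [:0, 1:] else 0) - [: M $ i $ j :])"

text \<open>Laplacian eigenvalues with multiplicity, in non-decreasing order (the Laplacian
  is real symmetric, so the characteristic polynomial splits over the reals).\<close>
definition laplacian_eigenvalues :: "('n::finite \<Rightarrow> 'n \<Rightarrow> bool) \<Rightarrow> real list" where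
  "laplacian_eigenvalues adj = sorted_list_of_multiset (proots (char_poly (laplacian adj)))"

definition algebraic_connectivity :: "('n::finite \<Rightarrow> 'n \<Rightarrow> bool) \<Rightarrow> real" where
  "algebraic_connectivity adj = laplacian_eigenvalues adj ! 1"

end

theory Submission
  imports Defs
begin

text \<open>
  By AM-GM on every edge, R is at most n / 2, so it suffices to bound a from below, that is, to bound
  the Laplacian energy of vectors of mean zero. Along a geodesic joining the extremes of such a vector
  the Cauchy--Schwarz inequality gives a \<ge> 2 / (n D), and comparison with the complementary graph
  gives a \<ge> 2 \<delta> - n + 2, which is at least 2 when \<delta> \<ge> n / 2. Both are
  sufficient since 1 - cos x \<le> x^2 / 2 bounds the right-hand side below by
  n^2 (n - 3 + 2 sqrt 2) / (2 pi^2).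
\<close>

section \<open>Spectral theorem and the characteristic polynomial\<close>

text \<open>A maximiser \<open>v\<close> of the Rayleigh quotient on the unit sphere of S is an
  eigenvector. Moving from \<open>v\<close> along the residual \<open>w = f v - l v\<close>, which
  stays in S by invariance, changes the quotient to first order by a multiple of |w|^2, so
  maximality forces w = 0.\<close>

lemma selfadjoint_eigenvector_exists:
  fixes f :: "'a::euclidean_space \<Rightarrow> 'a"
  assumes lin: "linear f" and sym: "\<And>x y. f x \<bullet> y = x \<bullet> f y"
    and S: "subspace S" and inv: "\<And>x. x \<in> S \<Longrightarrow> f x \<in> S"
    and nz: "z \<in> S" "z \<noteq> 0"
  obtains v l where "v \<in> S" "norm v = 1" "f v = l *\<^sub>R v"
proof -
  let ?K = "sphere 0 1 \<inter> S"
  have "compact ?K"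
    using S by (simp add: closed_subspace compact_Int_closed)
  moreover have "(1 / norm z) *\<^sub>R z \<in> ?K"
    using nz S by (simp add: subspace_scale)
  then have "?K \<noteq> {}" by blast
  moreover have "continuous_on ?K (\<lambda>x. f x \<bullet> x)"
    using lin by (intro continuous_intros linear_continuous_on linear_linear[THEN iffD2])
  ultimately obtain v where v: "v \<in> ?K" and max: "\<And>y. y \<in> ?K \<Longrightarrow> f y \<bullet> y \<le> f v \<bullet> v"
    using continuous_attains_sup[of ?K "\<lambda>x. f x \<bullet> x"] by blast
  define l where "l = f v \<bullet> v"
  have vS: "v \<in> S" and vn: "norm v = 1" using v by auto
  then have vv: "v \<bullet> v = 1" by (simp add: dot_square_norm)
  have le: "f x \<bullet> x \<le> l * (x \<bullet> x)" if "x \<in> S" for x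
  proof (cases "x = 0")
    case True
    then show ?thesis by simp
  next
    case False
    let ?y = "(1 / norm x) *\<^sub>R x"
    have "?y \<in> ?K" using False S that by (simp add: subspace_scale)
    then have "f ?y \<bullet> ?y \<le> l" unfolding l_def by (rule max)
    then have "(f x \<bullet> x) / (norm x)\<^sup>2 \<le> l"
      using lin by (simp add: linear_cmul power2_eq_square)
    then show ?thesis using False
      by (simp add: dot_square_norm divide_simps mult.commute)
  qed
  define w where "w = f v - l *\<^sub>R v"
  have wS: "w \<in> S" unfolding w_def
    using S vS inv by (simp add: subspace_diff subspace_scale)
  define c where "c = f w \<bullet> w - l * (w \<bullet> w)"
  define b where "b = w \<bullet> w"
  have fvw: "f v \<bullet> w - l * (v \<bullet> w) = b"
    unfolding b_def w_def by (simp add: algebra_simps)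
  \<comment> \<open>The maximum at v makes this quadratic in t nonpositive, so its linear coefficient b vanishes.\<close>
  have quad: "2 * t * b + t\<^sup>2 * c \<le> 0" for t
  proof -
    have "v + t *\<^sub>R w \<in> S" using S vS wS by (simp add: subspace_add subspace_scale)
    from le[OF this]
    have "l + t * (f v \<bullet> w) + t * (f w \<bullet> v) + t\<^sup>2 * (f w \<bullet> w)
      \<le> l * (1 + 2 * t * (v \<bullet> w) + t\<^sup>2 * (w \<bullet> w))"
      using lin by (simp add: l_def linear_add linear_cmul inner_add_left inner_add_right vv
          inner_commute power2_eq_square algebra_simps)
    moreover have "f w \<bullet> v = f v \<bullet> w" using sym[of w v] by (simp add: inner_commute)
    ultimately have "2 * t * (f v \<bullet> w - l * (v \<bullet> w)) + t\<^sup>2 * c \<le> 0"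
      unfolding c_def by (simp add: algebra_simps)
    then show ?thesis unfolding fvw .
  qed
  have c0: "c \<le> 0" unfolding c_def using le[OF wS] by simp
  have "b = 0"
  proof (rule ccontr)
    assume "b \<noteq> 0"
    \<comment> \<open>Any sufficiently small t of the sign of \<open>b\<close> contradicts
      \<open>quad\<close>. Since c \<le> 0, s is at least 1, so t = b / s is defined even for c = 0,
      and the quadratic takes the positive value b^2 (1 + s) / s^2.\<close>
    define s where "s = 1 - c"
    have s: "s > 0" "c = 1 - s" using c0 by (simp_all add: s_def)
    have "2 * (b / s) * b + (b / s)\<^sup>2 * c = b\<^sup>2 * (1 + s) / s\<^sup>2"
      using s(1) unfolding s(2) by (simp add: field_simps power2_eq_square)
    moreover have "b\<^sup>2 * (1 + s) / s\<^sup>2 > 0"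
      using s(1) \<open>b \<noteq> 0\<close> by simp
    ultimately show False using quad[of "b / s"] by simp
  qed
  then have "f v = l *\<^sub>R v" unfolding b_def w_def by simp
  with vS vn show ?thesis by (rule that)
qed

text \<open>Take an orthonormal set of eigenvectors of maximal size, which exists because such sets
  are independent. If it did not span, its orthogonal complement would be a nonzero invariant
  subspace and would supply one more eigenvector.\<close>

lemma selfadjoint_orthonormal_eigenbasis:
  fixes f :: "'a::euclidean_space \<Rightarrow> 'a"
  assumes lin: "linear f" and sym: "\<And>x y. f x \<bullet> y = x \<bullet> f y"
  obtains B where "pairwise orthogonal B" "\<And>v. v \<in> B \<Longrightarrow> norm v = 1"
    "\<And>v. v \<in> B \<Longrightarrow> \<exists>l. f v = l *\<^sub>R v" "finite B" "card B = DIM('a)"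
proof -
  define P where "P B \<longleftrightarrow> pairwise orthogonal B \<and> (\<forall>v\<in>B. norm v = 1) \<and> (\<forall>v\<in>B. \<exists>l. f v = l *\<^sub>R v)"
    for B
  have indep: "independent B" if "P B" for B
    using that unfolding P_def
    by (metis norm_zero pairwise_orthogonal_independent zero_neq_one)
  have bnd: "finite B \<and> card B \<le> DIM('a)" if "P B" for B
    using independent_bound[OF indep[OF that]] .
  have "P {}" by (simp add: P_def)
  then obtain B where B: "P B" and max: "\<And>C. P C \<Longrightarrow> card C \<le> card B"
    using ex_has_greatest_nat[of P "{}" card "Suc DIM('a)"] bnd by (metis le_imp_less_Suc)
  have "card B = DIM('a)"
  proof (rule ccontr)
    assume "card B \<noteq> DIM('a)"
    then have "dim B < DIM('a)"
      using bnd[OF B] indep[OF B] by (simp add: dim_eq_card_independent)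
    then obtain z where z: "z \<noteq> 0" "\<And>y. y \<in> span B \<Longrightarrow> orthogonal z y"
      using orthogonal_to_subspace_exists by blast
    let ?S = "{y. \<forall>x\<in>B. orthogonal x y}"
    have S: "subspace ?S" by (rule subspace_orthogonal_to_vectors)
    have inv: "f y \<in> ?S" if y: "y \<in> ?S" for y
    proof (clarify)
      fix x assume x: "x \<in> B"
      then obtain l where "f x = l *\<^sub>R x" using B unfolding P_def by blast
      then show "orthogonal x (f y)"
        using sym[of x y] y x by (simp add: orthogonal_def)
    qed
    have "z \<in> ?S" using z(2) span_base orthogonal_commute by blast
    from selfadjoint_eigenvector_exists[OF lin sym S inv this z(1)]
    obtain v l where v: "v \<in> ?S" "norm v = 1" "f v = l *\<^sub>R v" by blast
    have "v \<notin> B"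
    proof
      assume "v \<in> B"
      then have "orthogonal v v" using v(1) by blast
      then show False using v(2) by (simp add: orthogonal_def)
    qed
    moreover have "P (insert v B)"
      using B v unfolding P_def pairwise_insert by (auto simp: orthogonal_commute)
    ultimately show False
      using max[of "insert v B"] bnd[OF B] by simp
  qed
  with B bnd[OF B] show ?thesis
    by (intro that[of B]) (auto simp: P_def)
qed

text \<open>Indexing the basis by the matrix index type itself lets the eigenvectors serve as
  columns of a square matrix.\<close>

lemma symmetric_matrix_eigenbasis:
  fixes M :: "real^'n^'n"
  assumes "transpose M = M"
  obtains v :: "'n \<Rightarrow> real^'n" and l :: "'n \<Rightarrow> real"
  where "\<And>i j. v i \<bullet> v j = (if i = j then 1 else 0)" "\<And>i. M *v v i = l i *\<^sub>R v i"
proof -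
  have sym: "(M *v x) \<bullet> y = x \<bullet> (M *v y)" for x y :: "real^'n"
    by (metis assms dot_lmul_matrix vector_transpose_matrix)
  obtain B where B: "pairwise orthogonal B" "\<And>v. v \<in> B \<Longrightarrow> norm v = 1"
    "\<And>v. v \<in> B \<Longrightarrow> \<exists>l. M *v v = l *\<^sub>R v" "finite B" "card B = DIM(real^'n)"
    using selfadjoint_orthonormal_eigenbasis[OF matrix_vector_mul_linear[of M] sym] by blast
  obtain v where v: "bij_betw v (UNIV :: 'n set) B"
    using finite_same_card_bij[of "UNIV :: 'n set" B] B(4,5) by auto
  have vB: "v i \<in> B" for i using v by (auto simp: bij_betw_def)
  have "\<forall>i. \<exists>l. M *v v i = l *\<^sub>R v i" using B(3) vB by blast
  then obtain l where l: "\<And>i. M *v v i = l i *\<^sub>R v i" by metis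
  have "v i \<bullet> v j = (if i = j then 1 else 0)" for i j
  proof (cases "i = j")
    case True
    then show ?thesis using B(2)[OF vB] by (simp add: dot_square_norm)
  next
    case False
    then have "v i \<noteq> v j" using v by (auto simp: bij_betw_def inj_on_def)
    then show ?thesis using False B(1) vB by (auto simp: pairwise_def orthogonal_def)
  qed
  then show ?thesis using l by (rule that)
qed

lemma const_poly_sum: "[:sum f A:] = (\<Sum>x\<in>A. [:f x:])"
  proof (induction A rule: infinite_finite_induct)
  case (insert x A)
  have "[:f x + sum f A:] = [:f x:] + [:sum f A:]" by simp
  then show ?case using insert by (simp del: add_pCons)
qed simp_all

text \<open>Diagonalisation carried out over the polynomial ring: with the eigenvectors as constant
  columns of P, (X I - M) P = P D for D diagonal with entries X - l i. Taking determinants and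
  cancelling det P, which orthonormality makes nonzero, leaves the product of the diagonal.\<close>

lemma char_poly_eigenbasis:
  fixes M :: "real^'n^'n" and v :: "'n \<Rightarrow> real^'n"
  assumes orth: "\<And>i j. v i \<bullet> v j = (if i = j then 1 else 0)"
    and eig: "\<And>i. M *v v i = l i *\<^sub>R v i"
  shows "char_poly M = (\<Prod>i\<in>UNIV. [:- l i, 1:])"
proof -
  define P :: "real poly^'n^'n" where "P = (\<chi> i j. [:v j $ i:])"
  define D :: "real poly^'n^'n" where "D = (\<chi> i j. if i = j then [:- l i, 1:] else 0)"
  let ?A = "(\<chi> i j. (if i = j then [:0, 1:] else 0) - [: M $ i $ j :]) :: real poly^'n^'n"
  have "transpose P ** P = mat 1"
  proof -
    have "(\<Sum>k\<in>UNIV. [:v i $ k:] * [:v j $ k:]) = (if i = j then 1 else 0)" for i j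
    proof -
      have "(\<Sum>k\<in>UNIV. [:v i $ k:] * [:v j $ k:]) = [:v i \<bullet> v j:]"
        by (simp add: inner_vec_def const_poly_sum mult.commute)
      then show ?thesis by (simp add: orth)
    qed
    then show ?thesis
      by (simp add: P_def matrix_matrix_mult_def transpose_def mat_def vec_eq_iff)
  qed
  then have "det (transpose P) * det P = 1"
    by (metis det_I det_mul)
  then have "det P \<noteq> 0" by auto
  moreover have "?A ** P = P ** D"
  proof -
    have "(\<Sum>k\<in>UNIV. ((if i = k then [:0, 1:] else 0) - [:M $ i $ k:]) * [:v j $ k:])
        = (\<Sum>k\<in>UNIV. [:v k $ i:] * (if k = j then [:- l k, 1:] else 0))" for i j
    proof -
      have "(\<Sum>k\<in>UNIV. ((if i = k then [:0, 1:] else 0) - [:M $ i $ k:]) * [:v j $ k:])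
        = (\<Sum>k\<in>UNIV. if i = k then [:0, 1:] * [:v j $ k:] else 0) - (\<Sum>k\<in>UNIV. [:M $ i $ k:] * [:v j $ k:])"
        unfolding sum_subtractf[symmetric] by (rule sum.cong) (auto simp: left_diff_distrib)
      also have "(\<Sum>k\<in>UNIV. [:M $ i $ k:] * [:v j $ k:]) = [:(M *v v j) $ i:]"
        by (simp add: matrix_vector_mult_def const_poly_sum mult.commute)
      also have "\<dots> = [:l j * v j $ i:]" by (simp add: eig)
      also have "(\<Sum>k\<in>UNIV. if i = k then [:0, 1:] * [:v j $ k:] else 0) = [:0, 1:] * [:v j $ i:]"
        by simp
      also have "[:0, 1:] * [:v j $ i:] - [:l j * v j $ i:] = [:v j $ i:] * [:- l j, 1:]"
        by (simp add: mult.commute)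
      also have "\<dots> = (\<Sum>k\<in>UNIV. [:v k $ i:] * (if k = j then [:- l k, 1:] else 0))"
        by (simp add: if_distrib[of "\<lambda>x. _ * x"] cong: if_cong)
      finally show ?thesis .
    qed
    then show ?thesis
      by (simp add: P_def D_def matrix_matrix_mult_def vec_eq_iff)
  qed
  then have "det (?A ** P) = det (P ** D)" by (rule arg_cong)
  then have "det ?A * det P = det P * det D" unfolding det_mul .
  ultimately have "det ?A = det D" by simp
  also have "det D = (\<Prod>i\<in>UNIV. D $ i $ i)"
    by (rule det_diagonal) (simp add: D_def)
  also have "\<dots> = (\<Prod>i\<in>UNIV. [:- l i, 1:])" by (simp add: D_def)
  finally show ?thesis by (simp add: char_poly_def)
qed

text \<open>Multiplicities of roots become numbers of basis indices, so counting eigenvalues below a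
  threshold amounts to counting eigenvectors.\<close>

lemma proots_char_poly_eigenbasis:
  fixes M :: "real^'n^'n" and v :: "'n \<Rightarrow> real^'n"
  assumes orth: "\<And>i j. v i \<bullet> v j = (if i = j then 1 else 0)"
    and eig: "\<And>i. M *v v i = l i *\<^sub>R v i"
  shows "proots (char_poly M) = image_mset l (mset_set UNIV)"
proof -
  have "proots (char_poly M) = (\<Sum>i\<in>UNIV. {#l i#})"
    unfolding char_poly_eigenbasis[OF orth eig] by (subst proots_prod) auto
  also have "\<dots> = image_mset l (mset_set UNIV)"
    by (rule sum_unfold_sum_mset[THEN trans]) (simp add: sum_mset_singleton_mset flip: image_mset.compositionality)
  finally show ?thesis .
qed

section \<open>The second smallest eigenvalue of a symmetric matrix\<close>

text \<open>Positions start at 0, so \<open>! 1\<close> is the second smallest entry; were it below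
  c, the first entry would be too, making two entries below c.\<close>

lemma sorted_nth_1_ge:
  assumes "size A \<ge> 2" "size {#x \<in># A. x < c#} \<le> 1"
  shows "sorted_list_of_multiset A ! 1 \<ge> (c::'a::linorder)"
proof (rule ccontr)
  assume *: "\<not> ?thesis"
  define xs where "xs = sorted_list_of_multiset A"
  have A: "A = mset xs" and sorted: "sorted xs" by (simp_all add: xs_def)
  have "length xs \<ge> 2" using assms(1) A by simp
  then obtain a b ys where xs: "xs = a # b # ys"
    by (cases xs; cases "tl xs") auto
  then have "b < c" "a \<le> b" using * sorted by (auto simp flip: xs_def)
  then have "a < c" "b < c" by auto
  then show False using assms(2) unfolding A xs by simp
qed

lemma size_filter_less_image_mset:
  fixes l :: "'n::finite \<Rightarrow> real"
  shows "size {#x \<in># image_mset l (mset_set UNIV). x < c#} = card {i. l i < c}"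
  by (simp add: filter_mset_image_mset)

text \<open>Two orthonormal eigenvectors with eigenvalues below c would span a plane containing a
  nonzero vector orthogonal to w.\<close>

lemma second_eigenvalue_ge:
  fixes M :: "real^'n^'n"
  assumes sym: "transpose M = M" and card: "CARD('n) \<ge> 2"
    and bound: "\<And>x. w \<bullet> x = 0 \<Longrightarrow> c * (x \<bullet> x) \<le> x \<bullet> (M *v x)"
  shows "sorted_list_of_multiset (proots (char_poly M)) ! 1 \<ge> c"
proof -
  obtain v :: "'n \<Rightarrow> real^'n" and l where orth: "\<And>i j. v i \<bullet> v j = (if i = j then 1 else 0)"
    and eig: "\<And>i. M *v v i = l i *\<^sub>R v i"
    using symmetric_matrix_eigenbasis[OF sym] by metis
  have "card {i. l i < c} \<le> 1"
  proof (rule ccontr)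
    assume "\<not> ?thesis"
    then obtain i j where ij: "l i < c" "l j < c" "i \<noteq> j"
      by (metis (no_types, lifting) One_nat_def card_le_Suc0_iff_eq finite mem_Collect_eq)
    \<comment> \<open>One linear condition on two coefficients always has a nontrivial
      solution.\<close>
    obtain s t where st: "s * (w \<bullet> v i) + t * (w \<bullet> v j) = 0" "s \<noteq> 0 \<or> t \<noteq> 0"
    proof (cases "w \<bullet> v i = 0")
      case True
      then show ?thesis using that[of 1 0] by simp
    next
      case False
      then show ?thesis using that[of "w \<bullet> v j" "- (w \<bullet> v i)"] by simp
    qed
    let ?x = "s *\<^sub>R v i + t *\<^sub>R v j"
    have "w \<bullet> ?x = 0" using st by (simp add: inner_add_right)
    from bound[OF this]
    have "c * (s\<^sup>2 + t\<^sup>2) \<le> l i * s\<^sup>2 + l j * t\<^sup>2"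
      using ij(3) by (simp add: matrix_vector_right_distrib matrix_vector_mult_scaleR eig
          inner_add_left inner_add_right orth power2_eq_square algebra_simps)
    moreover have "l i * s\<^sup>2 + l j * t\<^sup>2 < c * (s\<^sup>2 + t\<^sup>2)"
      using ij st(2)
      by (cases "s = 0"; cases "t = 0")
        (auto simp: distrib_left intro!: add_strict_mono mult_strict_right_mono)
    ultimately show False by simp
  qed
  then show ?thesis
    unfolding proots_char_poly_eigenbasis[OF orth eig]
    by (intro sorted_nth_1_ge) (use card in \<open>simp_all add: size_filter_less_image_mset\<close>)
qed

section \<open>Lower bounds for the algebraic connectivity\<close>

text \<open>In the double-sum form, the two endpoints can be exchanged by \<open>sum.swap\<close>
  and the symmetry of adjacency.\<close>

lemma sum_adj_pairs:
  fixes adj :: "'n::finite \<Rightarrow> 'n \<Rightarrow> bool" and g :: "'n \<Rightarrow> 'n \<Rightarrow> real"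
  shows "(\<Sum>(u,v)\<in>{(u,v). adj u v}. g u v) = (\<Sum>u\<in>UNIV. \<Sum>v\<in>UNIV. if adj u v then g u v else 0)"
proof -
  have "(\<Sum>u\<in>UNIV. \<Sum>v\<in>UNIV. if adj u v then g u v else 0)
      = (\<Sum>p\<in>UNIV. if adj (fst p) (snd p) then g (fst p) (snd p) else 0)"
    by (simp add: sum.cartesian_product case_prod_beta)
  also have "\<dots> = (\<Sum>p\<in>{p. adj (fst p) (snd p)}. g (fst p) (snd p))"
    by (simp add: sum.If_cases)
  also have "{p. adj (fst p) (snd p)} = {(u, v). adj u v}" by auto
  finally show ?thesis by (simp add: case_prod_beta)
qed

lemma sum_adj_const:
  fixes adj :: "'n::finite \<Rightarrow> 'n \<Rightarrow> bool"
  shows "(\<Sum>v\<in>UNIV. if adj u v then c else (0::real)) = real (degree adj u) * c"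
  by (simp add: sum.If_cases degree_def)

text \<open>The sum runs over ordered pairs and meets every edge twice, hence the factor 1/2.
  Expanding the square gives the degree term twice and the adjacency term with coefficient
  -2.\<close>

lemma laplacian_quadratic_form:
  fixes adj :: "'n::finite \<Rightarrow> 'n \<Rightarrow> bool"
  assumes "simple_graph adj"
  shows "x \<bullet> (laplacian adj *v x) = (\<Sum>(u,v)\<in>{(u,v). adj u v}. (x $ u - x $ v)\<^sup>2) / 2"
proof -
  have sym: "adj u v = adj v u" for u v using assms by (auto simp: simple_graph_def)
  have 1: "(\<Sum>u\<in>UNIV. \<Sum>v\<in>UNIV. if adj u v then (x $ u)\<^sup>2 else 0) = (\<Sum>u\<in>UNIV. degree adj u * (x $ u)\<^sup>2)"
    by (simp add: sum_adj_const)
  have 2: "(\<Sum>u\<in>UNIV. \<Sum>v\<in>UNIV. if adj u v then (x $ v)\<^sup>2 else 0) = (\<Sum>u\<in>UNIV. degree adj u * (x $ u)\<^sup>2)"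
    by (subst sum.swap, subst sym) (rule 1)
  have "(\<Sum>u\<in>UNIV. \<Sum>v\<in>UNIV. if adj u v then (x $ u - x $ v)\<^sup>2 else 0)
     = (\<Sum>u\<in>UNIV. \<Sum>v\<in>UNIV. (if adj u v then (x $ u)\<^sup>2 else 0) + (if adj u v then (x $ v)\<^sup>2 else 0)
         - 2 * (if adj u v then x $ u * x $ v else 0))"
    by (intro sum.cong refl) (simp add: power2_diff)
  also have "\<dots> = 2 * ((\<Sum>u\<in>UNIV. degree adj u * (x $ u)\<^sup>2) - (\<Sum>u\<in>UNIV. \<Sum>v\<in>UNIV. if adj u v then x $ u * x $ v else 0))"
    by (simp add: sum_subtractf sum.distrib 1 2 flip: sum_distrib_left)
  also have "(\<Sum>u\<in>UNIV. degree adj u * (x $ u)\<^sup>2) - (\<Sum>u\<in>UNIV. \<Sum>v\<in>UNIV. if adj u v then x $ u * x $ v else 0)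
     = x \<bullet> (laplacian adj *v x)"
  proof -
    have "(laplacian adj *v x) $ u = degree adj u * x $ u - (\<Sum>v\<in>UNIV. if adj u v then x $ v else 0)" for u
    proof -
      have "(laplacian adj *v x) $ u
        = (\<Sum>v\<in>UNIV. (if u = v then degree adj u * x $ v else 0) - (if adj u v then x $ v else 0))"
        unfolding laplacian_def matrix_vector_mult_def
        by (simp add: left_diff_distrib if_distrib[of "\<lambda>a. a * _"] cong: if_cong)
      then show ?thesis by (simp add: sum_subtractf)
    qed
    then show ?thesis
      by (simp add: inner_vec_def right_diff_distrib sum_subtractf sum_distrib_left
          power2_eq_square mult.left_commute if_distrib[of "\<lambda>a. _ * a"] cong: if_cong)
  qed
  finally show ?thesis by (simp add: sum_adj_pairs)
qed

lemma laplacian_symmetric: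
  "simple_graph adj \<Longrightarrow> transpose (laplacian adj) = laplacian adj"
  by (auto simp: laplacian_def transpose_def vec_eq_iff simple_graph_def)

text \<open>The lower-bound half of Courant-Fischer, with the all-ones vector as \<open>w\<close>:
  orthogonality to it is exactly mean zero.\<close>

lemma algebraic_connectivity_ge:
  fixes adj :: "'n::finite \<Rightarrow> 'n \<Rightarrow> bool"
  assumes "simple_graph adj" "CARD('n) \<ge> 2"
    and "\<And>x :: real^'n. (\<Sum>u\<in>UNIV. x $ u) = 0 \<Longrightarrow>
      c * (\<Sum>u\<in>UNIV. (x $ u)\<^sup>2) \<le> (\<Sum>(u,v)\<in>{(u,v). adj u v}. (x $ u - x $ v)\<^sup>2) / 2"
  shows "algebraic_connectivity adj \<ge> c"
  unfolding algebraic_connectivity_def laplacian_eigenvalues_def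
proof (rule second_eigenvalue_ge[where w = "\<chi> i. 1"])
  fix x :: "real^'n" assume "(\<chi> i. 1) \<bullet> x = 0"
  then show "c * (x \<bullet> x) \<le> x \<bullet> (laplacian adj *v x)"
    unfolding laplacian_quadratic_form[OF assms(1)]
    using assms(3)[of x] by (simp add: inner_vec_def power2_eq_square)
qed (use assms laplacian_symmetric in auto)

text \<open>The Laplacian of the complement has quadratic form n |x|^2 - x \<bullet> L x on vectors of mean zero,
  which is at most 2 (n - 1 - \<delta>) |x|^2 since complementary degrees are at most n - 1 - \<delta>.\<close>

lemma algebraic_connectivity_ge_min_degree:
  fixes adj :: "'n::finite \<Rightarrow> 'n \<Rightarrow> bool"
  assumes G: "simple_graph adj" and n: "CARD('n) \<ge> 2"
  shows "algebraic_connectivity adj \<ge> 2 * real (min_degree adj) - real CARD('n) + 2"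
proof (rule algebraic_connectivity_ge[OF G n])
  fix x :: "real^'n" assume x0: "(\<Sum>u\<in>UNIV. x $ u) = 0"
  let ?n = "real CARD('n)" and ?N = "\<Sum>u\<in>UNIV. (x $ u)\<^sup>2"
  have sym: "adj u v = adj v u" for u v using G by (auto simp: simple_graph_def)
  define co where "co u v \<longleftrightarrow> \<not> adj u v \<and> u \<noteq> v" for u v
  have cosym: "co u v = co v u" for u v using sym by (auto simp: co_def)
  have codeg: "real (degree co u) \<le> ?n - 1 - real (min_degree adj)" for u
  proof -
    have "{v. co u v} = UNIV - insert u {v. adj u v}" by (auto simp: co_def)
    moreover have "u \<notin> {v. adj u v}" using G by (auto simp: simple_graph_def)
    ultimately have "degree co u = CARD('n) - Suc (degree adj u)"
      by (simp add: degree_def card_Diff_subset)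
    \<comment> \<open>This makes the truncated natural subtraction above exact, so that it can be
      carried over to the reals.\<close>
    moreover have "Suc (degree adj u) \<le> CARD('n)"
      using card_mono[of UNIV "insert u {v. adj u v}"] \<open>u \<notin> {v. adj u v}\<close> by (simp add: degree_def)
    moreover have "min_degree adj \<le> degree adj u" by (simp add: min_degree_def)
    ultimately show ?thesis by simp
  qed
  \<comment> \<open>The cross terms vanish because x has mean zero.\<close>
  have all: "(\<Sum>u\<in>UNIV. \<Sum>v\<in>UNIV. (x $ u - x $ v)\<^sup>2) = 2 * ?n * ?N"
    by (simp add: power2_diff sum.distrib sum_subtractf x0 flip: sum_distrib_left sum_distrib_right)
  have 1: "(\<Sum>u\<in>UNIV. \<Sum>v\<in>UNIV. if co u v then 2 * (x $ u)\<^sup>2 else 0) = (\<Sum>u\<in>UNIV. degree co u * (2 * (x $ u)\<^sup>2))"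
    by (simp add: sum_adj_const)
  have 2: "(\<Sum>u\<in>UNIV. \<Sum>v\<in>UNIV. if co u v then 2 * (x $ v)\<^sup>2 else 0) = (\<Sum>u\<in>UNIV. degree co u * (2 * (x $ u)\<^sup>2))"
    by (subst sum.swap, subst cosym) (rule 1)
  have "2 * ?n * ?N - (\<Sum>u\<in>UNIV. \<Sum>v\<in>UNIV. if adj u v then (x $ u - x $ v)\<^sup>2 else 0)
     = (\<Sum>u\<in>UNIV. \<Sum>v\<in>UNIV. if co u v then (x $ u - x $ v)\<^sup>2 else 0)"
    unfolding all[symmetric] sum_subtractf[symmetric]
    by (intro sum.cong refl) (auto simp: co_def)
  \<comment> \<open>This is (a - b)^2 \<le> 2 a^2 + 2 b^2 on every complementary pair; each vertex
    is then counted with its complementary degree.\<close>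
  also have "\<dots> \<le> (\<Sum>u\<in>UNIV. \<Sum>v\<in>UNIV. (if co u v then 2 * (x $ u)\<^sup>2 else 0) + (if co u v then 2 * (x $ v)\<^sup>2 else 0))"
  proof (intro sum_mono)
    fix u v
    have "0 \<le> (x $ u + x $ v)\<^sup>2" by simp
    then show "(if co u v then (x $ u - x $ v)\<^sup>2 else 0)
      \<le> (if co u v then 2 * (x $ u)\<^sup>2 else 0) + (if co u v then 2 * (x $ v)\<^sup>2 else 0)"
      by (simp add: power2_diff power2_sum)
  qed
  also have "\<dots> = (\<Sum>u\<in>UNIV. real (degree co u) * (4 * (x $ u)\<^sup>2))"
    unfolding sum.distrib 1 2 by (simp add: mult.left_commute flip: sum.distrib)
  also have "\<dots> \<le> (\<Sum>u\<in>UNIV. (?n - 1 - real (min_degree adj)) * (4 * (x $ u)\<^sup>2))"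
    by (intro sum_mono mult_right_mono codeg) simp
  also have "\<dots> = 4 * (?n - 1 - real (min_degree adj)) * ?N"
    unfolding sum_distrib_left by (intro sum.cong) (simp_all add: mult_ac)
  finally show "(2 * real (min_degree adj) - ?n + 2) * ?N
      \<le> (\<Sum>(u,v)\<in>{(u,v). adj u v}. (x $ u - x $ v)\<^sup>2) / 2"
    unfolding sum_adj_pairs by (simp add: algebra_simps)
qed

section \<open>Geodesics and the diameter bound\<close>

lemma walk_append: "walk adj i u w \<Longrightarrow> walk adj j w v \<Longrightarrow> walk adj (i + j) u v"
  by (induction i arbitrary: u) auto

lemma walk_vertices:
  "walk adj k u v \<Longrightarrow> \<exists>p. p 0 = u \<and> p k = v \<and> (\<forall>i<k. adj (p i) (p (Suc i)))"
proof (induction k arbitrary: u)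
  case (Suc k)
  then obtain w p where "adj u w" "p 0 = w" "p k = v" "\<forall>i<k. adj (p i) (p (Suc i))"
    by fastforce
  then show ?case
    by (intro exI[of _ "\<lambda>i. case i of 0 \<Rightarrow> u | Suc j \<Rightarrow> p j"]) (auto split: nat.split)
qed auto

lemma walk_segment:
  assumes "\<forall>i<k. adj (p i) (p (Suc i))" "i + m \<le> k"
  shows "walk adj m (p i) (p (i + m))"
  using assms
proof (induction m arbitrary: i)
  case (Suc m)
  then show ?case using Suc.IH[of "Suc i"] by (auto intro!: exI[of _ "p (Suc i)"])
qed auto

text \<open>If a shortest walk repeated a vertex, cutting out the closed stretch between the two
  visits would give a shorter walk.\<close>

lemma geodesic_exists:
  assumes "walk adj k0 u v"
  obtains p where "p 0 = u" "p (graph_dist adj u v) = v"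
    "\<forall>i<graph_dist adj u v. adj (p i) (p (Suc i))" "inj_on p {..graph_dist adj u v}"
proof -
  let ?k = "graph_dist adj u v"
  have "walk adj ?k u v" unfolding graph_dist_def using assms by (rule LeastI)
  then obtain p where p: "p 0 = u" "p ?k = v" "\<forall>i<?k. adj (p i) (p (Suc i))"
    using walk_vertices by metis
  have "p i \<noteq> p j" if "i < j" "j \<le> ?k" for i j
  proof
    assume eq: "p i = p j"
    have "walk adj i u (p i)" using walk_segment[where p = p, OF p(3), of 0 i] that p(1) by simp
    moreover have "walk adj (?k - j) (p i) v"
      using walk_segment[where p = p, OF p(3), of j "?k - j"] that p(2) eq by simp
    ultimately have "walk adj (i + (?k - j)) u v" by (rule walk_append)
    then have "?k \<le> i + (?k - j)" unfolding graph_dist_def by (rule Least_le)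
    then show False using that by simp
  qed
  then have "inj_on p {..?k}" by (metis atMost_iff inj_onI nat_neq_iff)
  with p show ?thesis by (rule that)
qed

lemma graph_dist_le_diameter: "graph_dist adj u v \<le> diameter (adj :: 'n::finite \<Rightarrow> 'n \<Rightarrow> bool)"
proof -
  have "{graph_dist adj u v | u v. True} = range (\<lambda>(u, v). graph_dist adj u v)" by auto
  then show ?thesis unfolding diameter_def by (auto intro!: Max_ge)
qed

text \<open>Telescope x along a geodesic and apply Cauchy-Schwarz to its at most D steps. The steps
  are distinct ordered pairs of adjacent vertices, so their squares are part of the full sum, which
  counts both orientations of every edge.\<close>

lemma diff_square_le_diameter_energy:
  fixes adj :: "'n::finite \<Rightarrow> 'n \<Rightarrow> bool" and x :: "'n \<Rightarrow> real"
  assumes "connected_graph adj"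
  shows "(x u - x v)\<^sup>2 \<le> diameter adj * (\<Sum>(a,b)\<in>{(a,b). adj a b}. (x a - x b)\<^sup>2)"
proof -
  let ?E = "\<Sum>(a,b)\<in>{(a,b). adj a b}. (x a - x b)\<^sup>2"
  let ?k = "graph_dist adj u v"
  obtain k0 where "walk adj k0 u v" using assms by (auto simp: connected_graph_def)
  then obtain p where p: "p 0 = u" "p ?k = v" "\<forall>i<?k. adj (p i) (p (Suc i))" "inj_on p {..?k}"
    using geodesic_exists by metis
  have "x u - x v = (\<Sum>i<?k. x (p i) - x (p (Suc i)))"
    using sum_lessThan_telescope'[of "x \<circ> p" ?k] p(1,2) by simp
  then have "(x u - x v)\<^sup>2 \<le> (\<Sum>i<?k. (x (p i) - x (p (Suc i)))\<^sup>2) * ?k"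
    using sum_squared_le_sum_of_squares[of "\<lambda>i. x (p i) - x (p (Suc i))" "{..<?k}"] by simp
  also have "(\<Sum>i<?k. (x (p i) - x (p (Suc i)))\<^sup>2)
      = (\<Sum>(a,b)\<in>(\<lambda>i. (p i, p (Suc i))) ` {..<?k}. (x a - x b)\<^sup>2)"
  proof (subst sum.reindex)
    \<comment> \<open>Distinct vertices on the geodesic ensure that no ordered pair is counted
      twice.\<close>
    show "inj_on (\<lambda>i. (p i, p (Suc i))) {..<?k}"
      using p(4) by (auto simp: inj_on_def)
  qed simp
  also have "\<dots> \<le> ?E"
    using p(3) by (intro sum_mono2) auto
  finally have "(x u - x v)\<^sup>2 \<le> ?k * ?E" by (simp add: mult.commute mult_right_mono)
  also have "\<dots> \<le> diameter adj * ?E"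
    by (intro mult_right_mono sum_nonneg) (auto simp: graph_dist_le_diameter)
  finally show ?thesis .
qed

lemma diameter_pos:
  fixes adj :: "'n::finite \<Rightarrow> 'n \<Rightarrow> bool"
  assumes "connected_graph adj" "CARD('n) \<ge> 2"
  shows "diameter adj > 0"
proof -
  obtain u v :: 'n where uv: "u \<noteq> v"
    using assms(2) by (metis (full_types) UNIV_I card_le_Suc0_iff_eq finite not_less_eq_eq numeral_2_eq_2)
  obtain k0 where "walk adj k0 u v" using assms by (auto simp: connected_graph_def)
  then have "walk adj (graph_dist adj u v) u v" unfolding graph_dist_def by (rule LeastI)
  then have "graph_dist adj u v \<noteq> 0" using uv by (metis walk.simps(1))
  then show ?thesis using graph_dist_le_diameter[of adj u v] by linarith
qed

text \<open>With extremes m and M of a mean-zero vector x, the sum of (M - x_u)(x_u - m) is nonnegative, so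
  |x|^2 is at most - n m M, hence at most n (M - m)^2 / 4; a geodesic between vertices
  where the extremes are attained bounds (M - m)^2 by the energy.\<close>

lemma algebraic_connectivity_ge_diameter:
  fixes adj :: "'n::finite \<Rightarrow> 'n \<Rightarrow> bool"
  assumes G: "simple_graph adj" and conn: "connected_graph adj" and n: "CARD('n) \<ge> 2"
  shows "algebraic_connectivity adj \<ge> 2 / (real CARD('n) * real (diameter adj))"
proof (rule algebraic_connectivity_ge[OF G n])
  fix x :: "real^'n" assume x0: "(\<Sum>u\<in>UNIV. x $ u) = 0"
  let ?n = "real CARD('n)" and ?N = "\<Sum>u\<in>UNIV. (x $ u)\<^sup>2"
  let ?E = "\<Sum>(u,v)\<in>{(u,v). adj u v}. (x $ u - x $ v)\<^sup>2" and ?d = "real (diameter adj)"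
  have "Max (range (($) x)) \<in> range (($) x)" "Min (range (($) x)) \<in> range (($) x)"
    by (intro Max_in Min_in; simp)+
  then obtain p q where p: "x $ p = Max (range (($) x))" and q: "x $ q = Min (range (($) x))"
    by (metis imageE)
  have "0 \<le> (\<Sum>u\<in>UNIV. (x $ p - x $ u) * (x $ u - x $ q))"
    by (intro sum_nonneg mult_nonneg_nonneg) (simp_all add: p q)
  also have "\<dots> = (\<Sum>u\<in>UNIV. (x $ p + x $ q) * x $ u - x $ p * x $ q - (x $ u)\<^sup>2)"
    by (intro sum.cong) (auto simp: algebra_simps power2_eq_square)
  also have "\<dots> = - ?n * (x $ p * x $ q) - ?N"
    by (simp add: sum_subtractf x0 flip: sum_distrib_left)
  finally have "?N \<le> ?n * (- (x $ p * x $ q))" by simp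
  also have "\<dots> \<le> ?n * ((x $ p - x $ q)\<^sup>2 / 4)"
  proof (rule mult_left_mono)
    have "0 \<le> (x $ p + x $ q)\<^sup>2" by simp
    then show "- (x $ p * x $ q) \<le> (x $ p - x $ q)\<^sup>2 / 4"
      by (simp add: power2_eq_square algebra_simps)
  qed simp
  also have "\<dots> \<le> ?n * (?d * ?E / 4)"
    using diff_square_le_diameter_energy[OF conn, of "($) x" p q]
    by (intro mult_left_mono) auto
  finally show "2 / (?n * ?d) * ?N \<le> ?E / 2"
    using n diameter_pos[OF conn n] by (simp add: field_simps)
qed

section \<open>The Randic index\<close>

text \<open>Each edge, as a two-element set, comes from exactly two ordered pairs because loops are
  excluded. The description in \<open>randic\<close> denotes a definite value because the weight is
  symmetric in the endpoints.\<close>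

lemma randic_eq_half_sum:
  fixes adj :: "'n::finite \<Rightarrow> 'n \<Rightarrow> bool"
  assumes "simple_graph adj"
  shows "randic adj = (\<Sum>(u,v)\<in>{(u,v). adj u v}. 1 / sqrt (real (degree adj u) * real (degree adj v))) / 2"
proof -
  have sym: "adj u v = adj v u" and irr: "\<not> adj u u" for u v
    using assms by (auto simp: simple_graph_def)
  define h where "h u v = 1 / sqrt (real (degree adj u) * real (degree adj v))" for u v
  define H where "H e = (THE r. \<exists>u v. e = {u, v} \<and> adj u v \<and> r = h u v)" for e
  have hsym: "h u v = h v u" for u v by (simp add: h_def mult.commute)
  have H: "H {u, v} = h u v" if "adj u v" for u v
    unfolding H_def by (rule the_equality) (use that hsym in \<open>auto simp: doubleton_eq_iff\<close>)
  let ?A = "{(u,v). adj u v}" and ?e = "\<lambda>(u,v). {u, v}"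
  have img: "?e ` ?A = {{u, v} | u v. adj u v}" by auto
  have "(\<Sum>(u,v)\<in>?A. h u v) = (\<Sum>e\<in>?e ` ?A. \<Sum>(u,v)\<in>{p \<in> ?A. ?e p = e}. h u v)"
    by (rule sum.image_gen) simp
  also have "\<dots> = (\<Sum>e\<in>?e ` ?A. 2 * H e)"
  proof (rule sum.cong)
    fix e assume "e \<in> ?e ` ?A"
    then obtain u v where uv: "e = {u, v}" "adj u v" by auto
    then have "{p \<in> ?A. ?e p = e} = {(u, v), (v, u)}" "u \<noteq> v"
      using sym irr by (auto simp: doubleton_eq_iff)
    then show "(\<Sum>(u,v)\<in>{p \<in> ?A. ?e p = e}. h u v) = 2 * H e"
      using uv by (simp add: H hsym[of v u])
  qed simp
  also have "\<dots> = 2 * randic adj"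
    unfolding img randic_def H_def h_def by (simp add: sum_distrib_left)
  finally show ?thesis by (simp add: h_def)
qed

text \<open>AM-GM splits each weight into 1 / (2 d(u)) + 1 / (2 d(v)). Summed over its neighbours, a
  vertex contributes at most 1/2 to either part; an isolated vertex contributes 0. Ordered pairs
  thus total at most n, and halving gives the bound.\<close>

lemma randic_le_half_order:
  fixes adj :: "'n::finite \<Rightarrow> 'n \<Rightarrow> bool"
  assumes "simple_graph adj"
  shows "randic adj \<le> real CARD('n) / 2"
proof -
  have sym: "adj u v = adj v u" for u v using assms by (auto simp: simple_graph_def)
  let ?d = "\<lambda>u. real (degree adj u)"
  have 1: "(\<Sum>u\<in>UNIV. \<Sum>v\<in>UNIV. if adj u v then 1 / (2 * ?d u) else 0) \<le> real CARD('n) / 2"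
    unfolding sum_adj_const by (rule order.trans[OF sum_bounded_above[where K = "1/2"]]) auto
  have 2: "(\<Sum>u\<in>UNIV. \<Sum>v\<in>UNIV. if adj u v then 1 / (2 * ?d v) else 0) \<le> real CARD('n) / 2"
    by (subst sum.swap, subst sym) (rule 1)
  have amgm: "1 / sqrt (?d u * ?d v) \<le> 1 / (2 * ?d u) + 1 / (2 * ?d v)" for u v
    using arith_geo_mean_sqrt[of "1 / ?d u" "1 / ?d v"]
    by (simp add: real_sqrt_divide add_divide_distrib)
  have "(\<Sum>(u,v)\<in>{(u,v). adj u v}. 1 / sqrt (?d u * ?d v))
    \<le> (\<Sum>u\<in>UNIV. \<Sum>v\<in>UNIV. (if adj u v then 1 / (2 * ?d u) else 0) + (if adj u v then 1 / (2 * ?d v) else 0))"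
    unfolding sum_adj_pairs by (intro sum_mono) (use amgm in auto)
  also have "\<dots> \<le> real CARD('n)" unfolding sum.distrib using 1 2 by linarith
  finally show ?thesis unfolding randic_eq_half_sum[OF assms] by simp
qed

section \<open>Comparison with the cosine bound\<close>

text \<open>Follows from 1 - cos x = 2 sin^2 (x/2) and |sin t| \<le> |t|.\<close>

lemma one_minus_cos_le: "1 - cos x \<le> x\<^sup>2 / (2::real)"
proof -
  have "(sin (x / 2))\<^sup>2 \<le> (x / 2)\<^sup>2"
    using abs_sin_x_le_abs_x[of "x / 2"] by (simp only: abs_le_square_iff)
  then show ?thesis using cos_double_sin[of "x / 2"] by (simp add: power_divide)
qed

theorem theorem2p7:
  fixes adj :: "'n::finite \<Rightarrow> 'n \<Rightarrow> bool"
  assumes "simple_graph adj"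
    and "connected_graph adj"
    and "CARD('n) \<ge> 3"
    and "real (diameter adj) \<le> 2 * (real CARD('n) - 3 + 2 * sqrt 2) / pi\<^sup>2
         \<or> real (min_degree adj) \<ge> real CARD('n) / 2"
  shows "randic adj / algebraic_connectivity adj
         \<le> ((real CARD('n) - 3 + 2 * sqrt 2) / 2) / (2 * (1 - cos (pi / real CARD('n))))"
proof -
  define n where "n = real CARD('n)"
  define k where "k = n - 3 + 2 * sqrt 2"
  have n3: "n \<ge> 3" using assms(3) by (simp add: n_def)
  \<comment> \<open>The constants 1.4, 2.8 and 16 are chosen so that 2 n k \<ge> 2 * 3 * 2.8 = 16.8
    exceeds the bound 16 for pi^2 in the minimum degree case.\<close>
  have "sqrt 2 \<ge> 1.4" by (rule real_le_rsqrt) (simp add: power2_eq_square)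
  then have k: "k \<ge> 2.8" using n3 by (simp add: k_def)
  have "pi\<^sup>2 \<le> 4\<^sup>2" using pi_less_4 pi_gt_zero by (intro power_mono) auto
  then have pi16: "pi\<^sup>2 \<le> 16" by simp
  \<comment> \<open>The common target n^2 k / (2 pi^2) is the claimed bound with 1 - cos (pi / n)
    replaced by (pi / n)^2 / 2.\<close>
  have "\<exists>c>0. algebraic_connectivity adj \<ge> c \<and> (n / 2) / c \<le> n\<^sup>2 * k / (2 * pi\<^sup>2)"
    using assms(4)
  proof
    let ?d = "real (diameter adj)"
    assume D: "?d \<le> 2 * (real CARD('n) - 3 + 2 * sqrt 2) / pi\<^sup>2"
    have d: "?d > 0" using diameter_pos[OF assms(2)] assms(3) by simp
    \<comment> \<open>With c = 2 / (n D), the target inequality is equivalent to the hypothesis D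
      \<le> 2 k / pi^2.\<close>
    have "(n / 2) / (2 / (n * ?d)) = n\<^sup>2 / 4 * ?d" by (simp add: power2_eq_square)
    also have "\<dots> \<le> n\<^sup>2 / 4 * (2 * k / pi\<^sup>2)"
      using D by (intro mult_left_mono) (auto simp: k_def n_def)
    finally have "(n / 2) / (2 / (n * ?d)) \<le> n\<^sup>2 * k / (2 * pi\<^sup>2)" by simp
    moreover have "algebraic_connectivity adj \<ge> 2 / (n * ?d)"
      using algebraic_connectivity_ge_diameter[OF assms(1,2)] assms(3) by (simp add: n_def)
    ultimately show ?thesis using d n3 by (intro exI[of _ "2 / (n * ?d)"]) auto
  next
    assume "real (min_degree adj) \<ge> real CARD('n) / 2"
    then have "algebraic_connectivity adj \<ge> 2"
      using algebraic_connectivity_ge_min_degree[OF assms(1)] assms(3) by linarith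
    moreover have "n / 2 / 2 \<le> n\<^sup>2 * k / (2 * pi\<^sup>2)"
    proof -
      have "3 * 2.8 \<le> n * k" using n3 k by (intro mult_mono) auto
      then have "n * pi\<^sup>2 \<le> n * (2 * (n * k))" using pi16 n3 by (intro mult_left_mono) auto
      then show ?thesis by (simp add: field_simps power2_eq_square)
    qed
    ultimately show ?thesis by (intro exI[of _ 2]) auto
  qed
  then obtain c where c: "c > 0" "algebraic_connectivity adj \<ge> c" "(n / 2) / c \<le> n\<^sup>2 * k / (2 * pi\<^sup>2)"
    by blast
  \<comment> \<open>Strict positivity ensures that replacing (pi / n)^2 / 2 by the smaller 1 - cos
    (pi / n) in the denominator can only increase the quotient.\<close>
  have cos: "0 < 1 - cos (pi / n)"
    using cos_monotone_0_pi[of 0 "pi / n"] n3 by (simp add: field_simps)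
  have "randic adj / algebraic_connectivity adj \<le> (n / 2) / c"
    using randic_le_half_order[OF assms(1)] c n3 by (intro frac_le) (auto simp: n_def)
  also have "\<dots> \<le> n\<^sup>2 * k / (2 * pi\<^sup>2)" by (rule c)
  also have "\<dots> = (k / 2) / (2 * ((pi / n)\<^sup>2 / 2))" using n3 by (simp add: power_divide)
  also have "\<dots> \<le> (k / 2) / (2 * (1 - cos (pi / n)))"
    using one_minus_cos_le[of "pi / n"] cos k n3
    by (intro divide_left_mono mult_pos_pos) auto
  finally show ?thesis by (simp add: k_def n_def)
qed

end
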